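(* Let $X$ be a well-behaved past-full chronological space. Then $(P(X),\mathrm{cl}^*d_1)$ is future-compact, i.e. $I^+(C)$ is precompact for all compact $C\subset P(X)$. For $p\in X$, each sequence $a:\mathbb{N}\to I^+(p)$ has a subsequence $b=a\circ j$ such that $n\mapsto I^-(b(n))$ converges in $(P(X),\mathrm{cl}^*d_1)$ to some $A\in P(X)$ (which is in general decomposable). If $U$ is a maximal indecomposable past subset in $A$, then $n\mapsto I^-(b(n))$ converges to $U$ in $(IP(X),\tau_-)$.
   Context: A chronological (chr.) set $(X,\ll)$ is a set $X$ with a transitive, irreflexive relation $\ll$ for which there is a countable $S\subset X$ such that $x\ll y$ implies $x\ll s\ll y$ for some $s\in S$. Put $I^-(x)=\{y: y\ll x\}$, $I^+(x)=\{y:x\ll y\}$, $I^\pm(A)=\bigcup_{x\in A}I^\pm(x)$. $A\subset X$ is past iff $I^-(A)=A$; $P(X)$ is the set of nonempty past subsets. $U\in P(X)$ is indecomposable iff $U=A\cup B$ with $A,B$ past implies $U=A$ or $U=B$; $IP(X)$ is the set of indecomposable past subsets; (indecomposable) future sets are defined dually. $X$ is preregular iff each $I^-(p)$ is empty or an indecomposable past set and each $I^+(p)$ is empty or an indecomposable future set; $I^-$-distinguishing iff $x\mapsto I^-(x)$ is injective; past-reflecting iff $I^-(x)\subset I^-(y)\Rightarrow I^+(y)\subset I^+(x)$; past-full iff $I^-(x)\neq\emptyset$ for all $x$. A chr. space is $(X,\tau,\ll)$ with $\tau$ a topology and $(X,\ll)$ an $I^-$-distinguishing, preregular, past-reflecting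 chr. set. It is regular iff moreover all $I^\pm(p)$ are open; path-generated iff $p\ll q$ implies that there is a continuous $c:[0,1]\to X$ with $c(0)=p$, $c(1)=q$, $s<t\Rightarrow c(s)\ll c(t)$. A regular path-generated chr. space is well-behaved iff $\tau$ is (metrizable,) locally compact, connected and locally arcwise connected. Fix a compatible intrinsic (length) metric $d_0$ on $X$ that is Heine-Borel (closed bounded sets are compact) and $x_0\in X$; for nonempty closed $A,B\subset X$ let $d_1(A,B)=\sup_{x\in X}|d_0(x,A)-d_0(x,B)|\,e^{-d_0(x_0,x)}$, and on $P(X)$ let $(\mathrm{cl}^*d_1)(A,B)=d_1(\mathrm{cl}A,\mathrm{cl}B)$. On $P(X)$: $A\ll_{BS}B$ iff there is $x\in B$ with $A\subset I^-(x)$; $A\ll_+B$ iff $U\ll_{BS}B$ for all $U\in IP(X)$ with $U\subset A$. For $C\subset P(X)$, $I^+(C)=\{B\in P(X):\exists A\in C,\ A\ll_+B\}$. Topology $\tau_-$ on $IP(X)$: $C\subset IP(X)$ is $\tau_-$-closed iff for every sequence $\sigma$ in $C$, $C\supset L_-(\sigma):=\{P\in IP(X): P\subset\liminf\sigma$ and $P$ is a maximal indecomposable past set in $\limsup\sigma\}$, where $\liminf\sigma=\bigcup_n\bigcap_{m\ge n}\sigma(m)$, $\limsup\sigma=\bigcap_n\bigcup_{m\ge n}\sigma(m)$, and maximality is with respect to inclusion. *)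

theory Defs
  imports "HOL-Analysis.Analysis"
begin

definition chr_set :: "('a \<Rightarrow> 'a \<Rightarrow> bool) \<Rightarrow> bool" where
  "chr_set R \<longleftrightarrow> transp R \<and> irreflp R \<and>
     (\<exists>S. countable S \<and> (\<forall>x y. R x y \<longrightarrow> (\<exists>s\<in>S. R x s \<and> R s y)))"

definition I_minus :: "('a \<Rightarrow> 'a \<Rightarrow> bool) \<Rightarrow> 'a \<Rightarrow> 'a set" where
  "I_minus R x = {y. R y x}"

definition I_plus :: "('a \<Rightarrow> 'a \<Rightarrow> bool) \<Rightarrow> 'a \<Rightarrow> 'a set" where
  "I_plus R x = {y. R x y}"

definition past_set :: "('a \<Rightarrow> 'a \<Rightarrow> bool) \<Rightarrow> 'a set \<Rightarrow> bool" where
  "past_set R A \<longleftrightarrow> (\<Union>x\<in>A. I_minus R x) = A"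

definition future_set :: "('a \<Rightarrow> 'a \<Rightarrow> bool) \<Rightarrow> 'a set \<Rightarrow> bool" where
  "future_set R A \<longleftrightarrow> (\<Union>x\<in>A. I_plus R x) = A"

definition Pasts :: "('a \<Rightarrow> 'a \<Rightarrow> bool) \<Rightarrow> 'a set set" where
  "Pasts R = {A. A \<noteq> {} \<and> past_set R A}"

definition Futures :: "('a \<Rightarrow> 'a \<Rightarrow> bool) \<Rightarrow> 'a set set" where
  "Futures R = {A. A \<noteq> {} \<and> future_set R A}"

definition IPasts :: "('a \<Rightarrow> 'a \<Rightarrow> bool) \<Rightarrow> 'a set set" where
  "IPasts R = {U \<in> Pasts R. \<forall>A B. past_set R A \<and> past_set R B \<and> U = A \<union> B \<longrightarrow> U = A \<or> U = B}"

definition IFutures :: "('a \<Rightarrow> 'a \<Rightarrow> bool) \<Rightarrow> 'a set set" where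
  "IFutures R = {U \<in> Futures R. \<forall>A B. future_set R A \<and> future_set R B \<and> U = A \<union> B \<longrightarrow> U = A \<or> U = B}"

definition preregular :: "('a \<Rightarrow> 'a \<Rightarrow> bool) \<Rightarrow> bool" where
  "preregular R \<longleftrightarrow> (\<forall>p. (I_minus R p = {} \<or> I_minus R p \<in> IPasts R) \<and>
                          (I_plus R p = {} \<or> I_plus R p \<in> IFutures R))"

definition past_distinguishing :: "('a \<Rightarrow> 'a \<Rightarrow> bool) \<Rightarrow> bool" where
  "past_distinguishing R \<longleftrightarrow> inj (I_minus R)"

definition past_reflecting :: "('a \<Rightarrow> 'a \<Rightarrow> bool) \<Rightarrow> bool" where
  "past_reflecting R \<longleftrightarrow> (\<forall>x y. I_minus R x \<subseteq> I_minus R y \<longrightarrow> I_plus R y \<subseteq> I_plus R x)"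

definition past_full :: "('a \<Rightarrow> 'a \<Rightarrow> bool) \<Rightarrow> bool" where
  "past_full R \<longleftrightarrow> (\<forall>x. I_minus R x \<noteq> {})"

text \<open>The underlying set is the whole type; the topology is the one of its type class.\<close>

definition chr_space :: "('a::topological_space \<Rightarrow> 'a \<Rightarrow> bool) \<Rightarrow> bool" where
  "chr_space R \<longleftrightarrow> chr_set R \<and> past_distinguishing R \<and> preregular R \<and> past_reflecting R"

definition regular_chr_space :: "('a::topological_space \<Rightarrow> 'a \<Rightarrow> bool) \<Rightarrow> bool" where
  "regular_chr_space R \<longleftrightarrow> chr_space R \<and> (\<forall>p. open (I_minus R p) \<and> open (I_plus R p))"

definition path_generated :: "('a::topological_space \<Rightarrow> 'a \<Rightarrow> bool) \<Rightarrow> bool" where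
  "path_generated R \<longleftrightarrow>
     (\<forall>p q. R p q \<longrightarrow>
        (\<exists>c. path c \<and> pathstart c = p \<and> pathfinish c = q \<and>
             (\<forall>s\<in>{0..1}. \<forall>t\<in>{0..1}. s < t \<longrightarrow> R (c s) (c t))))"

definition arc_connected :: "'a::topological_space set \<Rightarrow> bool" where
  "arc_connected S \<longleftrightarrow>
     (\<forall>x\<in>S. \<forall>y\<in>S. x \<noteq> y \<longrightarrow>
        (\<exists>g. arc g \<and> path_image g \<subseteq> S \<and> pathstart g = x \<and> pathfinish g = y))"

definition well_behaved :: "('a::topological_space \<Rightarrow> 'a \<Rightarrow> bool) \<Rightarrow> bool" where
  "well_behaved R \<longleftrightarrow> regular_chr_space R \<and> path_generated R \<and>
     metrizable_space (euclidean :: 'a topology) \<and>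
     locally_compact_space (euclidean :: 'a topology) \<and>
     connected (UNIV :: 'a set) \<and> locally arc_connected (UNIV :: 'a set)"

definition curve_length :: "('a \<Rightarrow> 'a \<Rightarrow> real) \<Rightarrow> (real \<Rightarrow> 'a) \<Rightarrow> ennreal" where
  "curve_length d c =
     (SUP (n, t) \<in> {(n::nat, t::nat \<Rightarrow> real). mono_on {..n} t \<and> t ` {..n} \<subseteq> {0..1}}.
        \<Sum>i<n. ennreal (d (c (t i)) (c (t (Suc i)))))"

definition intrinsic_metric :: "('a::topological_space \<Rightarrow> 'a \<Rightarrow> real) \<Rightarrow> bool" where
  "intrinsic_metric d \<longleftrightarrow>
     (\<forall>x y. ennreal (d x y) =
        (INF c \<in> {c. path c \<and> pathstart c = x \<and> pathfinish c = y}. curve_length d c))"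

text \<open>For nonempty \<open>A\<close> and \<open>B\<close> the set under the supremum is bounded above, because
  \<open>infdist x A \<le> dist x0 x + infdist x0 A\<close>.\<close>

definition d1 :: "'a::metric_space \<Rightarrow> 'a set \<Rightarrow> 'a set \<Rightarrow> real" where
  "d1 x0 A B = (SUP x. \<bar>infdist x A - infdist x B\<bar> * exp (- dist x0 x))"

definition cl_d1 :: "'a::metric_space \<Rightarrow> 'a set \<Rightarrow> 'a set \<Rightarrow> real" where
  "cl_d1 x0 A B = d1 x0 (closure A) (closure B)"

text \<open>If all \<open>I_plus R p\<close> are open, a past set \<open>A\<close> is the union of the \<open>I_minus R x\<close> for
  \<open>x \<in> closure A\<close>, so that \<open>cl_d1 x0\<close> is then a metric on \<open>Pasts R\<close>, not just a pseudometric.\<close>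

definition Pasts_topology :: "('a::metric_space \<Rightarrow> 'a \<Rightarrow> bool) \<Rightarrow> 'a \<Rightarrow> 'a set topology" where
  "Pasts_topology R x0 = Metric_space.mtopology (Pasts R) (cl_d1 x0)"

definition ll_BS :: "('a \<Rightarrow> 'a \<Rightarrow> bool) \<Rightarrow> 'a set \<Rightarrow> 'a set \<Rightarrow> bool" where
  "ll_BS R A B \<longleftrightarrow> (\<exists>x\<in>B. A \<subseteq> I_minus R x)"

definition ll_plus :: "('a \<Rightarrow> 'a \<Rightarrow> bool) \<Rightarrow> 'a set \<Rightarrow> 'a set \<Rightarrow> bool" where
  "ll_plus R A B \<longleftrightarrow> (\<forall>U\<in>IPasts R. U \<subseteq> A \<longrightarrow> ll_BS R U B)"

text \<open>Precompact means relatively compact, that is, having compact closure.\<close>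

definition future_compact :: "'b topology \<Rightarrow> ('b \<Rightarrow> 'b \<Rightarrow> bool) \<Rightarrow> bool" where
  "future_compact T L \<longleftrightarrow>
     (\<forall>C. compactin T C \<longrightarrow>
        compactin T (T closure_of {B \<in> topspace T. \<exists>A\<in>C. L A B}))"

definition set_liminf :: "(nat \<Rightarrow> 'a set) \<Rightarrow> 'a set" where
  "set_liminf \<sigma> = (\<Union>n. \<Inter>m\<in>{n..}. \<sigma> m)"

definition set_limsup :: "(nat \<Rightarrow> 'a set) \<Rightarrow> 'a set" where
  "set_limsup \<sigma> = (\<Inter>n. \<Union>m\<in>{n..}. \<sigma> m)"

definition maximal_IPast_in :: "('a \<Rightarrow> 'a \<Rightarrow> bool) \<Rightarrow> 'a set \<Rightarrow> 'a set \<Rightarrow> bool" where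
  "maximal_IPast_in R U A \<longleftrightarrow>
     U \<in> IPasts R \<and> U \<subseteq> A \<and> (\<forall>V\<in>IPasts R. U \<subseteq> V \<and> V \<subseteq> A \<longrightarrow> V = U)"

definition L_minus :: "('a \<Rightarrow> 'a \<Rightarrow> bool) \<Rightarrow> (nat \<Rightarrow> 'a set) \<Rightarrow> 'a set set" where
  "L_minus R \<sigma> = {P \<in> IPasts R. P \<subseteq> set_liminf \<sigma> \<and> maximal_IPast_in R P (set_limsup \<sigma>)}"

definition tau_minus_closed :: "('a \<Rightarrow> 'a \<Rightarrow> bool) \<Rightarrow> 'a set set \<Rightarrow> bool" where
  "tau_minus_closed R C \<longleftrightarrow>
     C \<subseteq> IPasts R \<and> (\<forall>\<sigma>. range \<sigma> \<subseteq> C \<longrightarrow> L_minus R \<sigma> \<subseteq> C)"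

definition tau_minus :: "('a \<Rightarrow> 'a \<Rightarrow> bool) \<Rightarrow> 'a set topology" where
  "tau_minus R = topology (\<lambda>U. U \<subseteq> IPasts R \<and> tau_minus_closed R (IPasts R - U))"

lemma L_minus_subseq:
  assumes "strict_mono j"
  shows "L_minus R \<sigma> \<subseteq> L_minus R (\<sigma> \<circ> j)"
proof
  fix P assume P: "P \<in> L_minus R \<sigma>"
  have j: "n \<le> j n" for n
    using assms by (rule strict_mono_imp_increasing)
  have inf: "set_liminf \<sigma> \<subseteq> set_liminf (\<sigma> \<circ> j)"
  proof
    fix x assume "x \<in> set_liminf \<sigma>"
    then obtain n where n: "\<And>m. m \<ge> n \<Longrightarrow> x \<in> \<sigma> m"
      by (auto simp: set_liminf_def)
    have "x \<in> (\<sigma> \<circ> j) m" if "m \<ge> n" for m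
      using n[of "j m"] j[of m] that by simp
    then show "x \<in> set_liminf (\<sigma> \<circ> j)"
      by (auto simp: set_liminf_def)
  qed
  have sup: "set_limsup (\<sigma> \<circ> j) \<subseteq> set_limsup \<sigma>"
  proof
    fix x assume x: "x \<in> set_limsup (\<sigma> \<circ> j)"
    have "\<exists>m\<ge>n. x \<in> \<sigma> m" for n
    proof -
      obtain m where m: "m \<ge> n" "x \<in> \<sigma> (j m)"
        using x by (auto simp: set_limsup_def)
      then show ?thesis using j[of m] by (intro exI[of _ "j m"]) simp
    qed
    then show "x \<in> set_limsup \<sigma>"
      by (auto simp: set_limsup_def)
  qed
  have mid: "set_liminf (\<sigma> \<circ> j) \<subseteq> set_limsup (\<sigma> \<circ> j)"
  proof
    fix x assume "x \<in> set_liminf (\<sigma> \<circ> j)"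
    then obtain n where n: "\<And>m. m \<ge> n \<Longrightarrow> x \<in> (\<sigma> \<circ> j) m"
      by (auto simp: set_liminf_def)
    have "\<exists>m\<ge>k. x \<in> (\<sigma> \<circ> j) m" for k
      using n[of "max n k"] by (intro exI[of _ "max n k"]) auto
    then show "x \<in> set_limsup (\<sigma> \<circ> j)"
      by (auto simp: set_limsup_def)
  qed
  show "P \<in> L_minus R (\<sigma> \<circ> j)"
  proof -
    have P': "P \<in> IPasts R" "P \<subseteq> set_liminf \<sigma>"
      "\<And>V. V \<in> IPasts R \<Longrightarrow> P \<subseteq> V \<Longrightarrow> V \<subseteq> set_limsup \<sigma> \<Longrightarrow> V = P"
      using P by (auto simp: L_minus_def maximal_IPast_in_def)
    have "P \<subseteq> set_liminf (\<sigma> \<circ> j)"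
      using P'(2) inf by (rule order_trans)
    moreover have "P \<subseteq> set_limsup (\<sigma> \<circ> j)"
      using calculation mid by (rule order_trans)
    moreover have "V = P" if "V \<in> IPasts R" "P \<subseteq> V" "V \<subseteq> set_limsup (\<sigma> \<circ> j)" for V
      using P'(3) that sup by (meson order_trans)
    ultimately show ?thesis
      using P'(1) by (simp add: L_minus_def maximal_IPast_in_def)
  qed
qed

lemma tau_minus_closed_Un:
  assumes "tau_minus_closed R C" "tau_minus_closed R D"
  shows "tau_minus_closed R (C \<union> D)"
  unfolding tau_minus_closed_def
proof (intro conjI allI impI)
  show "C \<union> D \<subseteq> IPasts R"
    using assms by (auto simp: tau_minus_closed_def)
  fix \<sigma> :: "nat \<Rightarrow> 'a set" assume \<sigma>: "range \<sigma> \<subseteq> C \<union> D"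
  have *: "L_minus R \<sigma> \<subseteq> E" if E: "infinite {n. \<sigma> n \<in> E}" "tau_minus_closed R E" for E
  proof -
    obtain j :: "nat \<Rightarrow> nat" where j: "strict_mono j" "\<And>n. j n \<in> {n. \<sigma> n \<in> E}"
      using infinite_enumerate[OF E(1)] by blast
    then have "range (\<sigma> \<circ> j) \<subseteq> E" by auto
    then show ?thesis
      using L_minus_subseq[OF j(1)] E(2) unfolding tau_minus_closed_def by blast
  qed
  have "{n. \<sigma> n \<in> C} \<union> {n. \<sigma> n \<in> D} = UNIV" using \<sigma> by auto
  then have "infinite {n. \<sigma> n \<in> C} \<or> infinite {n. \<sigma> n \<in> D}"
    by (metis finite_Un infinite_UNIV_nat)
  then show "L_minus R \<sigma> \<subseteq> C \<union> D"
    using * assms by blast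
qed

lemma istopology_tau_minus:
  "istopology (\<lambda>U. U \<subseteq> IPasts R \<and> tau_minus_closed R (IPasts R - U))"
  unfolding istopology_def
proof (intro conjI allI impI)
  fix S T
  assume "S \<subseteq> IPasts R \<and> tau_minus_closed R (IPasts R - S)"
    and "T \<subseteq> IPasts R \<and> tau_minus_closed R (IPasts R - T)"
  then show "tau_minus_closed R (IPasts R - S \<inter> T)" "S \<inter> T \<subseteq> IPasts R"
    using tau_minus_closed_Un[of R "IPasts R - S" "IPasts R - T"] by (auto simp: Diff_Int)
next
  fix K
  assume K: "\<forall>S\<in>K. S \<subseteq> IPasts R \<and> tau_minus_closed R (IPasts R - S)"
  then show "\<Union>K \<subseteq> IPasts R" by blast
  show "tau_minus_closed R (IPasts R - \<Union>K)"
    unfolding tau_minus_closed_def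
  proof (intro conjI allI impI)
    fix \<sigma> :: "nat \<Rightarrow> 'a set" assume \<sigma>: "range \<sigma> \<subseteq> IPasts R - \<Union>K"
    have "L_minus R \<sigma> \<subseteq> IPasts R - S" if "S \<in> K" for S
    proof -
      have "range \<sigma> \<subseteq> IPasts R - S" using \<sigma> that by blast
      then show ?thesis using K that unfolding tau_minus_closed_def by blast
    qed
    moreover have "L_minus R \<sigma> \<subseteq> IPasts R" by (auto simp: L_minus_def)
    ultimately show "L_minus R \<sigma> \<subseteq> IPasts R - \<Union>K" by blast
  qed blast
qed

lemma openin_tau_minus:
  "openin (tau_minus R) U \<longleftrightarrow> U \<subseteq> IPasts R \<and> tau_minus_closed R (IPasts R - U)"
  unfolding tau_minus_def by (simp add: topology_inverse' istopology_tau_minus)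

lemma topspace_tau_minus [simp]: "topspace (tau_minus R) = IPasts R"
proof -
  have "L_minus R \<sigma> \<subseteq> {}" if "range \<sigma> \<subseteq> {}" for \<sigma> :: "nat \<Rightarrow> 'a set"
    using that by simp
  then have "openin (tau_minus R) (IPasts R)"
    by (simp add: openin_tau_minus tau_minus_closed_def)
  then show ?thesis
    by (meson openin_subset openin_tau_minus openin_topspace subset_antisym)
qed

lemma closedin_tau_minus: "closedin (tau_minus R) C \<longleftrightarrow> tau_minus_closed R C"
  by (auto simp: closedin_def openin_tau_minus tau_minus_closed_def double_diff)

end

theory Submission
  imports Defs "HOL-Complex_Analysis.Great_Picard" "HOL-Real_Asymp.Real_Asymp"
begin

text \<open>
  In a proper space, sets whose distance to \<open>x0\<close> is bounded have a subsequence whose distance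
  functions converge pointwise to that of a closed nonempty set \<open>C\<close>, and this is convergence in
  \<open>d1\<close>. For past sets, openness of the futures shows that \<open>I\<^sup>-(C)\<close> is eventually contained
  in the sequence pointwise, and path-generatedness with past-fullness shows that its closure is
  \<open>C\<close>; so \<open>I\<^sup>-(C)\<close> is the limit. Hence past sets of bounded distance to \<open>x0\<close> form a
  compact set, and \<open>ll_plus R A B\<close> forces \<open>A \<subseteq> B\<close>, which bounds the distance of \<open>B\<close>
  by that of \<open>A\<close>. Finally the limit \<open>A\<close> lies in the liminf of the sequence while every past set
  inside the limsup lies in \<open>A\<close>, for every subsequence.
\<close>

section \<open>Convergence of distance functions\<close>

lemma infdist_closure [simp]: "infdist x (closure A) = infdist x A"
  by (simp add: infdist_eq_setdist)

text \<open>A set and its closure have the same distance function, so all estimates can be made for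
  \<open>d1\<close> on the sets themselves.\<close>

lemma cl_d1_eq: "cl_d1 x0 A B = d1 x0 A B"
  by (simp add: cl_d1_def d1_def)

lemma mult_exp_minus_le_1: "t * exp (- t) \<le> (1::real)"
proof -
  have "t \<le> exp t"
    using exp_ge_add_one_self[of t] by linarith
  then show ?thesis
    by (simp add: exp_minus field_simps)
qed

text \<open>Distance functions are 1-Lipschitz, so the term is controlled by
  \<open>dist x0 x\<close> and the two values at \<open>x0\<close> alone. This gives both finiteness
  of the supremum and smallness far from \<open>x0\<close>.\<close>

lemma d1_term_le:
  "\<bar>infdist x A - infdist x B\<bar> * exp (- dist x0 x)
     \<le> (2 * dist x0 x + infdist x0 A + infdist x0 B) * exp (- dist x0 x)"
proof (rule mult_right_mono)
  show "\<bar>infdist x A - infdist x B\<bar> \<le> 2 * dist x0 x + infdist x0 A + infdist x0 B"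
    using infdist_triangle[of x A x0] infdist_triangle[of x B x0]
      infdist_nonneg[of x A] infdist_nonneg[of x B] infdist_nonneg[of x0 A] infdist_nonneg[of x0 B]
    by (simp add: dist_commute)
qed simp

lemma bdd_above_d1:
  "bdd_above (range (\<lambda>x. \<bar>infdist x A - infdist x B\<bar> * exp (- dist x0 x)))"
proof (rule bdd_aboveI2)
  fix x
  have "(infdist x0 A + infdist x0 B) * exp (- dist x0 x) \<le> (infdist x0 A + infdist x0 B) * 1"
    by (rule mult_left_mono) (auto simp: infdist_nonneg)
  then show "\<bar>infdist x A - infdist x B\<bar> * exp (- dist x0 x) \<le> 2 + infdist x0 A + infdist x0 B"
    using d1_term_le[of x A B x0] mult_exp_minus_le_1[of "dist x0 x"] by (simp add: algebra_simps)
qed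

lemma d1_upper: "\<bar>infdist x A - infdist x B\<bar> * exp (- dist x0 x) \<le> d1 x0 A B"
  unfolding d1_def by (rule cSUP_upper[OF UNIV_I bdd_above_d1])

lemma d1_least:
  "(\<And>x. \<bar>infdist x A - infdist x B\<bar> * exp (- dist x0 x) \<le> e) \<Longrightarrow> d1 x0 A B \<le> e"
  unfolding d1_def by (rule cSUP_least) auto

lemma infdist_diff_le_d1: "\<bar>infdist x0 A - infdist x0 B\<bar> \<le> d1 x0 A B"
  using d1_upper[of x0 A B x0] by simp

lemma d1_nonneg: "0 \<le> d1 x0 A B"
  using infdist_diff_le_d1[of x0 A B] by linarith

lemma d1_commute: "d1 x0 A B = d1 x0 B A"
  by (simp add: d1_def abs_minus_commute)

lemma d1_triangle: "d1 x0 A C \<le> d1 x0 A B + d1 x0 B C"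
proof (rule d1_least)
  fix x
  have "\<bar>infdist x A - infdist x C\<bar> * exp (- dist x0 x)
      \<le> (\<bar>infdist x A - infdist x B\<bar> + \<bar>infdist x B - infdist x C\<bar>) * exp (- dist x0 x)"
    by (intro mult_right_mono) auto
  also have "\<dots> \<le> d1 x0 A B + d1 x0 B C"
    using d1_upper[of x A B x0] d1_upper[of x B C x0] by (simp add: algebra_simps)
  finally show "\<bar>infdist x A - infdist x C\<bar> * exp (- dist x0 x) \<le> d1 x0 A B + d1 x0 B C" .
qed

text \<open>A closed nonempty set is the zero set of its distance function. Nonemptiness matters
  because \<open>infdist\<close> to \<open>{}\<close> is 0 by convention, like the distance to the
  whole space.\<close>

lemma d1_eq_0_iff:
  assumes "A \<noteq> {}" "B \<noteq> {}"
  shows "d1 x0 A B = 0 \<longleftrightarrow> closure A = closure B"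
proof
  assume "d1 x0 A B = 0"
  then have "\<bar>infdist x A - infdist x B\<bar> * exp (- dist x0 x) \<le> 0" for x
    using d1_upper[of x A B x0] by simp
  then have "infdist x A = infdist x B" for x
    by (auto simp: mult_le_0_iff)
  then show "closure A = closure B"
    using in_closure_iff_infdist_zero[OF assms(1)] in_closure_iff_infdist_zero[OF assms(2)]
    by auto
next
  assume "closure A = closure B"
  then have "infdist x A = infdist x B" for x
    by (metis infdist_closure)
  then show "d1 x0 A B = 0"
    by (simp add: d1_def)
qed

lemma d1_tendsto_imp_infdist_tendsto:
  assumes "(\<lambda>n. d1 x0 (B n) A) \<longlonglongrightarrow> 0"
  shows "(\<lambda>n. infdist x (B n)) \<longlonglongrightarrow> infdist x A"
proof -
  have lim0: "(\<lambda>n. d1 x0 (B n) A * exp (dist x0 x)) \<longlonglongrightarrow> 0"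
    using tendsto_mult_right[OF assms] by simp
  have "norm (infdist x (B n) - infdist x A) \<le> d1 x0 (B n) A * exp (dist x0 x)" for n
    using d1_upper[of x "B n" A x0] by (simp add: exp_minus field_simps)
  then have "\<forall>\<^sub>F n in sequentially. norm (infdist x (B n) - infdist x A) \<le> d1 x0 (B n) A * exp (dist x0 x)"
    by (intro always_eventually allI)
  then have "(\<lambda>n. infdist x (B n) - infdist x A) \<longlonglongrightarrow> 0"
    using lim0 by (rule Lim_null_comparison)
  then show ?thesis
    by (simp add: LIM_zero_iff)
qed

section \<open>Compactness of distance functions in a proper space\<close>

lemma proper_finite_net:
  fixes x0 :: "'a::metric_space"
  assumes "\<forall>K :: 'a set. closed K \<and> bounded K \<longrightarrow> compact K" "0 < e"
  obtains F where "finite F" "\<And>x. dist x0 x \<le> r \<Longrightarrow> \<exists>y\<in>F. dist x y < e"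
proof -
  have "compact (cball x0 r)"
    by (simp add: assms)
  then obtain F where "finite F" "cball x0 r \<subseteq> (\<Union>y\<in>F. ball y e)"
    using \<open>0 < e\<close> unfolding compact_eq_totally_bounded by blast
  then show ?thesis
    by (intro that[of F]) (auto simp: subset_iff dist_commute)
qed

lemma proper_countable_dense:
  assumes "\<forall>K :: 'a::metric_space set. closed K \<and> bounded K \<longrightarrow> compact K"
  obtains D :: "'a::metric_space set" where "countable D" "\<And>x e. 0 < e \<Longrightarrow> \<exists>y\<in>D. dist x y < e"
proof -
  fix x0 :: 'a
  have "\<exists>F. finite F \<and> (\<forall>x. dist x0 x \<le> real n \<longrightarrow> (\<exists>y\<in>F. dist x y < inverse (real (Suc k))))" for n k
    using proper_finite_net[OF assms, where e = "inverse (real (Suc k))" and r = "real n" and ?x0.0 = x0]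
    by (metis inverse_positive_iff_positive of_nat_0_less_iff zero_less_Suc)
  then obtain F where F: "\<And>n k. finite (F n k)"
    "\<And>n k x. dist x0 x \<le> real n \<Longrightarrow> \<exists>y\<in>F n k. dist x y < inverse (real (Suc k))"
    by metis
  show ?thesis
  \<comment> \<open>The nets \<open>F n k\<close> exhaust the space by balls of radius
    \<open>n\<close>, with mesh tending to 0 in \<open>k\<close>.\<close>
  proof (rule that[of "\<Union>n k. F n k"])
    show "countable (\<Union>n k. F n k)"
      by (intro countable_UN) (auto intro: countable_finite F(1))
    fix x and e :: real assume "0 < e"
    then obtain k where k: "inverse (real (Suc k)) < e"
      using reals_Archimedean by blast
    obtain n where n: "dist x0 x \<le> real n"
      using real_arch_simple by blast
    obtain y where y: "y \<in> F n k" "dist x y < inverse (real (Suc k))"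
      using F(2)[OF n] by blast
    have "dist x y < e"
      using y(2) k by (rule less_trans)
    then show "\<exists>y\<in>(\<Union>n k. F n k). dist x y < e"
      using y(1) by blast
  qed
qed

text \<open>Pointwise convergence of the distance functions is convergence in \<open>d1\<close>: they are
  1-Lipschitz, hence converge uniformly on balls, and the weight controls the rest.\<close>

lemma infdist_tendsto_imp_d1_tendsto:
  fixes x0 :: "'a::metric_space"
  assumes proper: "\<forall>K :: 'a set. closed K \<and> bounded K \<longrightarrow> compact K"
    and lim: "\<And>x. (\<lambda>n. infdist x (B n)) \<longlonglongrightarrow> infdist x A"
  shows "(\<lambda>n. d1 x0 (B n) A) \<longlonglongrightarrow> 0"
proof (rule LIMSEQ_I)
  fix e :: real assume e: "0 < e"
  obtain M where M: "\<And>n. infdist x0 (B n) \<le> M"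
  proof -
    have "Bseq (\<lambda>n. infdist x0 (B n))"
      using lim convergentI convergent_imp_Bseq by blast
    then obtain K where "\<And>n. norm (infdist x0 (B n)) \<le> K"
      unfolding Bseq_def by blast
    then have "infdist x0 (B n) \<le> K" for n
      unfolding real_norm_def by (rule abs_le_D1)
    then show ?thesis
      by (rule that)
  qed
  \<comment> \<open>\<open>b\<close> absorbs both distances at \<open>x0\<close>, so that outside
    the radius \<open>r\<close> chosen next the bound of \<open>d1_term_le\<close> is below
    \<open>e / 2\<close> for all \<open>n\<close> at once.\<close>
  define b where "b = M + infdist x0 A"
  have "((\<lambda>t::real. (2 * t + b) * exp (- t)) \<longlongrightarrow> 0) at_top"
    by real_asymp
  then have "\<forall>\<^sub>F t in at_top. (2 * t + b) * exp (- t) < e / 2"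
    using e by (intro order_tendstoD) auto
  then obtain r where r: "\<And>t. t \<ge> r \<Longrightarrow> (2 * t + b) * exp (- t) < e / 2"
    by (auto simp: eventually_at_top_linorder)
  \<comment> \<open>Moving to a net point costs \<open>e / 8\<close> for each of the two distance
    functions, and convergence there costs \<open>e / 4\<close>, in total \<open>e / 2\<close>. The
    remaining half restores strictness after passing to the supremum.\<close>
  obtain F where F: "finite F" "\<And>x. dist x0 x \<le> r \<Longrightarrow> \<exists>y\<in>F. dist x y < e / 8"
    using proper_finite_net[OF proper, of "e / 8" x0 r] e by auto
  have "\<forall>\<^sub>F n in sequentially. \<bar>infdist y (B n) - infdist y A\<bar> < e / 4" for y
    using tendstoD[OF lim[of y], of "e / 4"] e by (simp add: dist_real_def)
  then have "\<forall>\<^sub>F n in sequentially. \<forall>y\<in>F. \<bar>infdist y (B n) - infdist y A\<bar> < e / 4"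
    using F(1) by (intro eventually_ball_finite) auto
  then obtain N where N: "\<And>n y. n \<ge> N \<Longrightarrow> y \<in> F \<Longrightarrow> \<bar>infdist y (B n) - infdist y A\<bar> < e / 4"
    by (auto simp: eventually_sequentially)
  have "d1 x0 (B n) A \<le> e / 2" if n: "n \<ge> N" for n
  proof (rule d1_least)
    fix x
    show "\<bar>infdist x (B n) - infdist x A\<bar> * exp (- dist x0 x) \<le> e / 2"
    proof (cases "dist x0 x \<le> r")
      case True
      then obtain y where y: "y \<in> F" "dist x y < e / 8"
        using F(2) by blast
      have "\<bar>infdist x (B n) - infdist x A\<bar> \<le> e / 2"
        using N[OF n y(1)] y(2) infdist_triangle_abs[of x "B n" y] infdist_triangle_abs[of x A y]
        by linarith
      moreover have "\<bar>infdist x (B n) - infdist x A\<bar> * exp (- dist x0 x)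
          \<le> \<bar>infdist x (B n) - infdist x A\<bar> * 1"
        by (rule mult_left_mono) auto
      ultimately show ?thesis
        unfolding mult_1_right by (rule order_trans[rotated])
    next
      case False
      note d1_term_le[of x "B n" A x0]
      also have "(2 * dist x0 x + infdist x0 (B n) + infdist x0 A) * exp (- dist x0 x)
          \<le> (2 * dist x0 x + b) * exp (- dist x0 x)"
        using M[of n] by (intro mult_right_mono) (auto simp: b_def)
      also have "\<dots> \<le> e / 2"
        using False by (intro less_imp_le r) simp
      finally show ?thesis .
    qed
  qed
  then show "\<exists>N. \<forall>n\<ge>N. norm (d1 x0 (B n) A - 0) < e"
    using e d1_nonneg[of x0] by (intro exI[of _ N]) force
qed

text \<open>An Arzela-Ascoli argument: a diagonal subsequence converges on a countable dense set,
  and the common Lipschitz constant 1 extends the convergence to every point.\<close>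

lemma infdist_convergent_subsequence:
  fixes x0 :: "'a::metric_space"
  assumes proper: "\<forall>K :: 'a set. closed K \<and> bounded K \<longrightarrow> compact K"
    and bound: "\<And>n. infdist x0 (B n) \<le> r"
  obtains k :: "nat \<Rightarrow> nat" where "strict_mono k"
    "\<And>x. convergent (\<lambda>n. infdist x (B (k n)))"
proof -
  obtain D :: "'a set" where D: "countable D" "\<And>x e. 0 < e \<Longrightarrow> \<exists>y\<in>D. dist x y < e"
    using proper_countable_dense[OF proper] by blast
  \<comment> \<open>The weight makes the bound uniform in \<open>x\<close>.\<close>
  have "norm (infdist x (B n) * exp (- dist x0 x)) \<le> 1 + r" for n x
  proof -
    have "infdist x (B n) * exp (- dist x0 x) \<le> (dist x0 x + r) * exp (- dist x0 x)"
      using infdist_triangle[of x "B n" x0] bound[of n]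
      by (intro mult_right_mono) (auto simp: dist_commute)
    also have "\<dots> \<le> 1 + r * exp (- dist x0 x)"
      using mult_exp_minus_le_1[of "dist x0 x"] by (simp add: algebra_simps)
    also have "r * exp (- dist x0 x) \<le> r * 1"
      using order_trans[OF infdist_nonneg bound] by (intro mult_left_mono) auto
    finally show ?thesis
      by (simp add: infdist_nonneg abs_mult)
  qed
  then obtain k where k: "strict_mono (k :: nat \<Rightarrow> nat)"
    "\<And>x. x \<in> D \<Longrightarrow> \<exists>l. (\<lambda>n. infdist x (B (k n)) * exp (- dist x0 x)) \<longlonglongrightarrow> l"
    using function_convergent_subsequence[OF D(1), of "\<lambda>n x. infdist x (B n) * exp (- dist x0 x)"]
    by metis
  have conv: "convergent (\<lambda>n. infdist x (B (k n)))" if x: "x \<in> D" for x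
  proof -
    obtain l where "(\<lambda>n. infdist x (B (k n)) * exp (- dist x0 x)) \<longlonglongrightarrow> l"
      using k(2)[OF x] by blast
    then have "(\<lambda>n. infdist x (B (k n)) * exp (- dist x0 x) * exp (dist x0 x)) \<longlonglongrightarrow> l * exp (dist x0 x)"
      by (rule tendsto_mult_right)
    then show ?thesis
      by (intro convergentI[of _ "l * exp (dist x0 x)"]) (simp add: exp_minus mult.assoc)
  qed
  have "Cauchy (\<lambda>n. infdist x (B (k n)))" for x
  proof (rule metric_CauchyI)
    fix e :: real assume e: "0 < e"
    obtain y where y: "y \<in> D" "dist x y < e / 3"
      using D(2)[of "e / 3" x] e by auto
    obtain N where N: "\<And>m n. m \<ge> N \<Longrightarrow> n \<ge> N \<Longrightarrow> dist (infdist y (B (k m))) (infdist y (B (k n))) < e / 3"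
      using metric_CauchyD[OF convergent_Cauchy[OF conv[OF y(1)]], of "e / 3"] e by auto
    have "dist (infdist x (B (k m))) (infdist x (B (k n))) < e" if "m \<ge> N" "n \<ge> N" for m n
      using N[OF that] y(2) infdist_triangle_abs[of x "B (k m)" y] infdist_triangle_abs[of x "B (k n)" y]
      unfolding dist_real_def by linarith
    then show "\<exists>N. \<forall>m\<ge>N. \<forall>n\<ge>N. dist (infdist x (B (k m))) (infdist x (B (k n))) < e"
      by blast
  qed
  then show ?thesis
    using k(1) that Cauchy_convergent_iff by blast
qed

text \<open>The set is the zero set of \<open>g\<close>. Properness makes almost nearest points
  accumulate at a zero of \<open>g\<close> no farther than \<open>g x\<close>; the reverse
  inequality is the Lipschitz bound inherited by \<open>g\<close>.\<close>

lemma infdist_limit: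
  fixes g :: "'a::metric_space \<Rightarrow> real"
  assumes proper: "\<forall>K :: 'a set. closed K \<and> bounded K \<longrightarrow> compact K"
    and ne: "\<And>n. B n \<noteq> {}"
    and lim: "\<And>x. (\<lambda>n. infdist x (B n)) \<longlonglongrightarrow> g x"
  obtains C where "closed C" "C \<noteq> {}" "\<And>x. g x = infdist x C"
proof
  define C where "C = {x. g x = 0}"
  have g_lip: "\<bar>g x - g y\<bar> \<le> dist x y" for x y
    by (rule LIMSEQ_le_const2[OF tendsto_rabs[OF tendsto_diff[OF lim lim]]])
      (use infdist_triangle_abs in blast)
  have near: "\<exists>c\<in>C. dist x c \<le> g x" for x
  proof -
    \<comment> \<open>The sets need not be closed, so the distance may not be attained; the slack
      \<open>inverse (real (Suc n))\<close> vanishes in the limit.\<close>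
    have "\<exists>b\<in>B n. dist x b < infdist x (B n) + inverse (real (Suc n))" for n
      using cInf_lessD[of "dist x ` B n" "infdist x (B n) + inverse (real (Suc n))"] ne[of n]
      by (auto simp: infdist_notempty)
    then obtain b where b: "\<And>n. b n \<in> B n"
      "\<And>n. dist x (b n) < infdist x (B n) + inverse (real (Suc n))"
      by metis
    have lim': "(\<lambda>n. infdist x (B n) + inverse (real (Suc n))) \<longlonglongrightarrow> g x"
      using tendsto_add[OF lim LIMSEQ_inverse_real_of_nat] by simp
    obtain K where K: "\<And>n. norm (infdist x (B n) + inverse (real (Suc n))) \<le> K"
      using convergent_imp_Bseq[OF convergentI[OF lim']] unfolding Bseq_def by blast
    have "dist x (b n) \<le> K" for n
      using b(2)[of n] K[of n] unfolding real_norm_def by linarith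
    then have "range b \<subseteq> cball x K"
      by auto
    moreover have "seq_compact (cball x K)"
      using proper by (simp add: compact_imp_seq_compact)
    ultimately obtain c s where s: "strict_mono s" "(b \<circ> s) \<longlonglongrightarrow> c"
      unfolding seq_compact_def by (meson rangeI subsetD)
    have "(\<lambda>n. dist x (b (s n))) \<longlonglongrightarrow> dist x c"
      using s(2) by (intro tendsto_intros) (simp add: comp_def)
    moreover have "(\<lambda>n. infdist x (B (s n)) + inverse (real (Suc (s n)))) \<longlonglongrightarrow> g x"
      using LIMSEQ_subseq_LIMSEQ[OF lim' s(1)] by (simp add: comp_def)
    ultimately have "dist x c \<le> g x"
      by (rule LIMSEQ_le) (meson b(2) less_imp_le)
    moreover have "g c = 0"
    proof -
      have "(\<lambda>n. infdist c (B (s n))) \<longlonglongrightarrow> g c"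
        using LIMSEQ_subseq_LIMSEQ[OF lim s(1)] by (simp add: comp_def)
      moreover have "(\<lambda>n. dist c (b (s n))) \<longlonglongrightarrow> dist c c"
        using s(2) by (intro tendsto_intros) (simp add: comp_def)
      ultimately have "g c \<le> dist c c"
        by (rule LIMSEQ_le) (meson b(1) infdist_le)
      moreover have "0 \<le> g c"
        using LIMSEQ_le_const[OF lim] infdist_nonneg by blast
      ultimately show ?thesis by simp
    qed
    ultimately show ?thesis
      by (auto simp: C_def)
  qed
  show "C \<noteq> {}"
    using near by blast
  have "continuous_on UNIV g"
    unfolding continuous_on_iff
    using g_lip by (metis dist_commute dist_real_def le_less_trans)
  then show "closed C"
    unfolding C_def by (intro closed_Collect_eq) auto
  show "g x = infdist x C" for x
  proof (rule antisym)
    show "infdist x C \<le> g x"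
      using near infdist_le2 by metis
    show "g x \<le> infdist x C"
      unfolding infdist_notempty[OF \<open>C \<noteq> {}\<close>]
    proof (rule cINF_greatest[OF \<open>C \<noteq> {}\<close>])
      show "g x \<le> dist x c" if "c \<in> C" for c
        using that g_lip[of x c] by (simp add: C_def)
    qed
  qed
qed

section \<open>Past sets and their closures\<close>

lemma past_set_iff: "past_set R A \<longleftrightarrow> (\<forall>y. y \<in> A \<longleftrightarrow> (\<exists>x\<in>A. R y x))"
  by (auto simp: past_set_def I_minus_def)

lemma past_setD: "past_set R A \<Longrightarrow> x \<in> A \<Longrightarrow> R y x \<Longrightarrow> y \<in> A"
  unfolding past_set_iff by blast

lemma past_set_above: "past_set R A \<Longrightarrow> y \<in> A \<Longrightarrow> \<exists>x\<in>A. R y x"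
  unfolding past_set_iff by blast

text \<open>Transitivity makes the union closed downwards, and the interpolating points of the
  countable set put above each of its points another one in the union.\<close>

lemma chr_set_past_set_UN:
  assumes "chr_set R"
  shows "past_set R (\<Union>x\<in>C. I_minus R x)"
  using assms unfolding chr_set_def past_set_iff I_minus_def transp_def by blast

text \<open>If \<open>y\<close> precedes a point of the closure, the open future of \<open>y\<close>
  meets \<open>A\<close> itself, so \<open>y\<close> lies in \<open>A\<close>. A past set is thus
  determined by its closure.\<close>

lemma regular_past_set_closure:
  assumes "regular_chr_space R" "past_set R A"
  shows "A = (\<Union>x\<in>closure A. I_minus R x)"
proof
  show "A \<subseteq> (\<Union>x\<in>closure A. I_minus R x)"
    using assms(2) closure_subset by (fastforce simp: past_set_def)
  show "(\<Union>x\<in>closure A. I_minus R x) \<subseteq> A"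
  proof (clarsimp simp: I_minus_def)
    fix x y assume x: "x \<in> closure A" and "R y x"
    then have "I_plus R y \<inter> closure A \<noteq> {}"
      by (auto simp: I_plus_def)
    then have "I_plus R y \<inter> A \<noteq> {}"
      using assms(1) by (simp add: regular_chr_space_def open_Int_closure_eq_empty)
    then show "y \<in> A"
      using past_setD[OF assms(2)] by (auto simp: I_plus_def)
  qed
qed

text \<open>By past-fullness some chronological path ends at \<open>x\<close>; its points before the
  end lie in the past of \<open>x\<close> and converge to \<open>x\<close>.\<close>

lemma in_closure_I_minus:
  assumes "path_generated R" "past_full R"
  shows "x \<in> closure (I_minus R x)"
proof -
  obtain y where "R y x"
    using assms(2) by (auto simp: past_full_def I_minus_def)
  then obtain c where c: "path c" "pathfinish c = x"
    "\<And>s t. s \<in> {0..1} \<Longrightarrow> t \<in> {0..1} \<Longrightarrow> s < t \<Longrightarrow> R (c s) (c t)"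
    using assms(1) unfolding path_generated_def by metis
  define u where "u n = 1 - inverse (real (Suc n))" for n
  have u: "u n \<in> {0..1}" "u n < 1" for n
    by (auto simp: u_def inverse_le_1_iff)
  have "u \<longlonglongrightarrow> 1"
    using tendsto_diff[OF tendsto_const LIMSEQ_inverse_real_of_nat, of 1] unfolding u_def by simp
  then have "(\<lambda>n. c (u n)) \<longlonglongrightarrow> c 1"
    by (rule continuous_on_tendsto_compose[OF c(1)[unfolded path_def]]) (use u(1) in auto)
  moreover have "c (u n) \<in> I_minus R x" for n
    using c(2) c(3)[of "u n" 1] u[of n] by (auto simp: I_minus_def pathfinish_def)
  then have "\<forall>\<^sub>F n in sequentially. c (u n) \<in> closure (I_minus R x)"
    using closure_subset by (intro always_eventually) blast
  ultimately have "c 1 \<in> closure (I_minus R x)"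
    by (intro Lim_in_closed_set[of "closure (I_minus R x)" "\<lambda>n. c (u n)" sequentially]) auto
  then show ?thesis
    using c(2) by (simp add: pathfinish_def)
qed

lemma I_minus_in_IPasts:
  assumes "well_behaved R" "past_full R"
  shows "I_minus R x \<in> IPasts R"
  using assms
  by (auto simp: well_behaved_def regular_chr_space_def chr_space_def preregular_def past_full_def)

lemma IPasts_subset_Pasts: "IPasts R \<subseteq> Pasts R"
  by (auto simp: IPasts_def)

text \<open>The pasts of points of \<open>A\<close> are indecomposable past subsets that cover
  \<open>A\<close>, and \<open>ll_plus\<close> places each of them below a point of
  \<open>B\<close>.\<close>

lemma ll_plus_imp_subset:
  assumes "well_behaved R" "past_full R" "A \<in> Pasts R" "B \<in> Pasts R" "ll_plus R A B"
  shows "A \<subseteq> B"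
proof
  fix z assume "z \<in> A"
  then obtain y where y: "y \<in> A" "R z y"
    using assms(3) by (auto simp: Pasts_def dest: past_set_above)
  have "I_minus R y \<subseteq> A"
    using assms(3) y(1) by (auto simp: Pasts_def I_minus_def dest: past_setD)
  then have "ll_BS R (I_minus R y) B"
    using assms(5) I_minus_in_IPasts[OF assms(1,2)] by (simp add: ll_plus_def)
  then obtain x where "x \<in> B" "R z x"
    using y(2) by (auto simp: ll_BS_def I_minus_def)
  then show "z \<in> B"
    using assms(4) by (auto simp: Pasts_def dest: past_setD)
qed

section \<open>The metric space of past sets\<close>

text \<open>Only separation needs an argument: distance 0 means equal closures, and past sets with
  equal closures coincide.\<close>

lemma Metric_space_Pasts:
  assumes "regular_chr_space R"
  shows "Metric_space (Pasts R) (cl_d1 x0)"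
proof
  fix A B C assume "A \<in> Pasts R" "B \<in> Pasts R"
  then show "cl_d1 x0 A B = 0 \<longleftrightarrow> A = B"
    using d1_eq_0_iff[of A B x0] regular_past_set_closure[OF assms]
    unfolding cl_d1_eq Pasts_def by blast
qed (auto simp: cl_d1_eq d1_nonneg d1_commute d1_triangle)

lemma limitin_Pasts_iff:
  assumes "regular_chr_space R"
  shows "limitin (Pasts_topology R x0) B A sequentially \<longleftrightarrow>
    A \<in> Pasts R \<and> (\<forall>\<^sub>F n in sequentially. B n \<in> Pasts R) \<and> (\<lambda>n. d1 x0 (B n) A) \<longlonglongrightarrow> 0"
  unfolding Pasts_topology_def Metric_space.limitin_metric_dist_null[OF Metric_space_Pasts[OF assms]]
  by (simp add: cl_d1_eq)

text \<open>The future of \<open>y\<close> is a neighbourhood of \<open>x\<close>, which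
  \<open>B n\<close> meets once it is close enough to \<open>x\<close>; being a past set,
  \<open>B n\<close> then contains \<open>y\<close>.\<close>

lemma eventually_mem_below_limit:
  assumes R: "regular_chr_space R"
    and B: "\<And>n. B n \<in> Pasts R" and C: "C \<noteq> {}"
    and lim: "\<And>x. (\<lambda>n. infdist x (B n)) \<longlonglongrightarrow> infdist x C"
    and y: "x \<in> C" "R y x"
  shows "\<forall>\<^sub>F n in sequentially. y \<in> B n"
proof -
  have "open (I_plus R y)" "x \<in> I_plus R y"
    using R y(2) by (auto simp: regular_chr_space_def I_plus_def)
  then obtain e where e: "0 < e" "ball x e \<subseteq> I_plus R y"
    using openE by blast
  have "(\<lambda>n. infdist x (B n)) \<longlonglongrightarrow> 0"
    using lim[of x] y(1) by simp
  then have "\<forall>\<^sub>F n in sequentially. infdist x (B n) < e"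
    using e(1) by (rule order_tendstoD)
  then show ?thesis
  proof (rule eventually_mono)
    fix n assume "infdist x (B n) < e"
    moreover have "B n \<noteq> {}"
      using B[of n] by (simp add: Pasts_def)
    ultimately obtain b where "b \<in> B n" "dist x b < e"
      by (auto simp: infdist_notempty cINF_less_iff)
    then have "b \<in> B n" "R y b"
      using e(2) by (auto simp: I_plus_def subset_iff)
    then show "y \<in> B n"
      using B[of n] by (auto simp: Pasts_def dest: past_setD)
  qed
qed

lemma Pasts_convergent_subsequence:
  fixes R :: "'a::metric_space \<Rightarrow> 'a \<Rightarrow> bool"
  assumes wb: "well_behaved R" and full: "past_full R"
    and proper: "\<forall>K :: 'a set. closed K \<and> bounded K \<longrightarrow> compact K"
    and B: "\<And>n. B n \<in> Pasts R" and bound: "\<And>n. infdist x0 (B n) \<le> r"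
  obtains k A where "strict_mono (k :: nat \<Rightarrow> nat)" "A \<in> Pasts R"
    "limitin (Pasts_topology R x0) (B \<circ> k) A sequentially"
proof -
  have reg: "regular_chr_space R" and gen: "path_generated R"
    using wb by (auto simp: well_behaved_def)
  obtain k :: "nat \<Rightarrow> nat" where k: "strict_mono k" "\<And>x. convergent (\<lambda>n. infdist x (B (k n)))"
    by (rule infdist_convergent_subsequence[of x0 B r, OF proper bound]) blast
  have "\<And>n. B (k n) \<noteq> {}"
    using B by (auto simp: Pasts_def)
  then obtain C where C: "closed C" "C \<noteq> {}" "\<And>x. lim (\<lambda>n. infdist x (B (k n))) = infdist x C"
    using infdist_limit[OF proper, of "\<lambda>n. B (k n)" "\<lambda>x. lim (\<lambda>n. infdist x (B (k n)))"]
      convergent_LIMSEQ_iff[THEN iffD1, OF k(2)] by metis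
  have limC: "(\<lambda>n. infdist x (B (k n))) \<longlonglongrightarrow> infdist x C" for x
    using k(2)[of x] C(3)[of x] by (simp add: convergent_LIMSEQ_iff)
  \<comment> \<open>The limit set \<open>C\<close> of the distance functions is closed and need not
    be a past set; its past has the same closure, hence the same distance function.\<close>
  define A where "A = (\<Union>x\<in>C. I_minus R x)"
  have "A \<subseteq> C"
  proof
    fix y assume "y \<in> A"
    then obtain x where "x \<in> C" "R y x"
      by (auto simp: A_def I_minus_def)
    then have "\<forall>\<^sub>F n in sequentially. y \<in> B (k n)"
      using eventually_mem_below_limit[OF reg B C(2) limC] by blast
    then have "\<forall>\<^sub>F n in sequentially. infdist y (B (k n)) = 0"
      by (rule eventually_mono) simp
    then have "(\<lambda>n. infdist y (B (k n))) \<longlonglongrightarrow> 0"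
      by (rule tendsto_eventually)
    then have "infdist y C = 0"
      using LIMSEQ_unique limC by blast
    then show "y \<in> C"
      using C(1,2) by (simp add: in_closed_iff_infdist_zero)
  qed
  moreover have "C \<subseteq> closure A"
  proof
    fix x assume "x \<in> C"
    then show "x \<in> closure A"
      using in_closure_I_minus[OF gen full, of x] closure_mono[of "I_minus R x" A]
      by (auto simp: A_def)
  qed
  ultimately have "closure A = C"
    using C(1) by (meson closure_minimal subset_antisym)
  then have "infdist x C = infdist x A" for x
    by (metis infdist_closure)
  then have "(\<lambda>n. d1 x0 (B (k n)) A) \<longlonglongrightarrow> 0"
    using infdist_tendsto_imp_d1_tendsto[OF proper] limC by metis
  moreover have "A \<in> Pasts R"
    using chr_set_past_set_UN[of R C] reg \<open>closure A = C\<close> C(2)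
    by (auto simp: Pasts_def A_def regular_chr_space_def chr_space_def)
  ultimately show ?thesis
    using that[OF k(1)] B by (simp add: limitin_Pasts_iff[OF reg])
qed

section \<open>Metric limits compared with liminf and limsup\<close>

lemma Pasts_limit_subset_liminf:
  assumes "regular_chr_space R" "\<And>n. B n \<in> Pasts R"
    and "limitin (Pasts_topology R x0) B A sequentially"
  shows "A \<subseteq> set_liminf B"
proof
  fix y assume y: "y \<in> A"
  have A: "A \<in> Pasts R" and lim: "(\<lambda>n. d1 x0 (B n) A) \<longlonglongrightarrow> 0"
    using assms(3) by (auto simp: limitin_Pasts_iff[OF assms(1)])
  \<comment> \<open>A past set has no last point, so \<open>y\<close> lies strictly below a point of
    the limit.\<close>
  obtain x where "x \<in> A" "R y x"
    using y A by (auto simp: Pasts_def dest: past_set_above)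
  then have "\<forall>\<^sub>F n in sequentially. y \<in> B n"
    using eventually_mem_below_limit[OF assms(1,2) _ d1_tendsto_imp_infdist_tendsto[OF lim]] by blast
  then show "y \<in> set_liminf B"
    by (auto simp: set_liminf_def eventually_sequentially)
qed

lemma limsup_subset_closure_Pasts_limit:
  assumes "regular_chr_space R"
    and "limitin (Pasts_topology R x0) B A sequentially"
  shows "set_limsup B \<subseteq> closure A"
proof
  fix w assume w: "w \<in> set_limsup B"
  have A: "A \<noteq> {}" and lim: "(\<lambda>n. d1 x0 (B n) A) \<longlonglongrightarrow> 0"
    using assms(2) by (auto simp: limitin_Pasts_iff[OF assms(1)] Pasts_def)
  \<comment> \<open>\<open>w\<close> lies in \<open>B m\<close> for arbitrarily large
    \<open>m\<close>, where its distance to \<open>B m\<close> is 0.\<close>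
  have "infdist w A \<le> e" if e: "0 < e" for e
  proof -
    obtain N where "\<And>n. n \<ge> N \<Longrightarrow> \<bar>infdist w (B n) - infdist w A\<bar> < e"
      using LIMSEQ_D[OF d1_tendsto_imp_infdist_tendsto[OF lim] e] by fastforce
    moreover obtain m where "m \<ge> N" "w \<in> B m"
      using w by (auto simp: set_limsup_def)
    ultimately show ?thesis
      by fastforce
  qed
  then have "infdist w A = 0"
    using field_le_epsilon[of "infdist w A" 0] infdist_nonneg[of w A] by simp
  then show "w \<in> closure A"
    using A by (simp add: in_closure_iff_infdist_zero)
qed

lemma set_liminf_subset_set_limsup: "set_liminf B \<subseteq> set_limsup B"
proof
  fix x assume "x \<in> set_liminf B"
  then obtain n where n: "\<And>m. n \<le> m \<Longrightarrow> x \<in> B m"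
    by (auto simp: set_liminf_def)
  have "\<exists>m\<ge>k. x \<in> B m" for k
    using n[of "max n k"] by (intro exI[of _ "max n k"]) simp
  then show "x \<in> set_limsup B"
    by (auto simp: set_limsup_def)
qed

text \<open>If infinitely many members avoid an open \<open>V\<close> containing \<open>U\<close>,
  they form a sequence in the closed complement of \<open>V\<close>. Its metric limit is still
  \<open>A\<close>, which forces \<open>U\<close> into its \<open>L_minus\<close> set and hence out
  of \<open>V\<close>.\<close>

lemma limitin_tau_minus_of_Pasts_limit:
  assumes reg: "regular_chr_space R" and B: "\<And>n. B n \<in> IPasts R"
    and lim: "limitin (Pasts_topology R x0) B A sequentially"
    and U: "maximal_IPast_in R U A"
  shows "limitin (tau_minus R) B U sequentially"
  unfolding limitin_def
proof (intro conjI allI impI)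
  have A: "A \<in> Pasts R"
    using lim by (simp add: limitin_Pasts_iff[OF reg])
  have UIP: "U \<in> IPasts R" "U \<subseteq> A"
    using U by (auto simp: maximal_IPast_in_def)
  then show "U \<in> topspace (tau_minus R)"
    by simp
  fix V assume V: "openin (tau_minus R) V \<and> U \<in> V"
  show "\<forall>\<^sub>F n in sequentially. B n \<in> V"
  proof (rule ccontr)
    assume "\<not> (\<forall>\<^sub>F n in sequentially. B n \<in> V)"
    then have "infinite {n. B n \<notin> V}"
      by (simp add: eventually_cofinite flip: cofinite_eq_sequentially)
    then obtain k :: "nat \<Rightarrow> nat" where k: "strict_mono k" "\<And>n. B (k n) \<notin> V"
      using infinite_enumerate by blast
    have lim': "limitin (Pasts_topology R x0) (B \<circ> k) A sequentially"
      using limitin_subsequence[OF k(1) lim] .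
    have liminf: "A \<subseteq> set_liminf (B \<circ> k)"
      using Pasts_limit_subset_liminf[OF reg _ lim'] B IPasts_subset_Pasts[of R] by auto
    \<comment> \<open>This turns maximality of \<open>U\<close> in \<open>A\<close> into maximality
      in the limsup: a past set inside the closure of \<open>A\<close> lies in the past of that
      closure, which is \<open>A\<close>.\<close>
    have "W \<subseteq> A" if W: "W \<in> IPasts R" "W \<subseteq> set_limsup (B \<circ> k)" for W
    proof -
      have "W = (\<Union>x\<in>W. I_minus R x)"
        using W(1) by (simp add: IPasts_def Pasts_def past_set_def)
      also have "\<dots> \<subseteq> (\<Union>x\<in>closure A. I_minus R x)"
        using W(2) limsup_subset_closure_Pasts_limit[OF reg lim'] by blast
      also have "\<dots> = A"
        using regular_past_set_closure[OF reg] A by (auto simp: Pasts_def)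
      finally show ?thesis .
    qed
    moreover have "U \<subseteq> set_liminf (B \<circ> k)"
      using UIP(2) liminf by (rule order_trans)
    moreover have "U \<subseteq> set_limsup (B \<circ> k)"
      using calculation(2) set_liminf_subset_set_limsup by (rule order_trans)
    ultimately have "U \<in> L_minus R (B \<circ> k)"
      using U by (auto simp: L_minus_def maximal_IPast_in_def)
    moreover have "range (B \<circ> k) \<subseteq> IPasts R - V"
      using B k(2) by auto
    ultimately have "U \<in> IPasts R - V"
      using V unfolding openin_tau_minus tau_minus_closed_def by blast
    then show False
      using V by blast
  qed
qed

section \<open>Compactness and future-compactness\<close>

lemma compactin_Pasts_infdist_le:
  fixes R :: "'a::metric_space \<Rightarrow> 'a \<Rightarrow> bool"
  assumes wb: "well_behaved R" and full: "past_full R"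
    and proper: "\<forall>K :: 'a set. closed K \<and> bounded K \<longrightarrow> compact K"
  shows "compactin (Pasts_topology R x0) {B \<in> Pasts R. infdist x0 B \<le> r}" (is "compactin _ ?S")
proof -
  have reg: "regular_chr_space R"
    using wb by (simp add: well_behaved_def)
  \<comment> \<open>In a metric space sequential compactness suffices; the bound at
    \<open>x0\<close> survives the limit because the distances at \<open>x0\<close>
    converge.\<close>
  have "\<exists>A k. A \<in> ?S \<and> strict_mono k \<and> limitin (Pasts_topology R x0) (\<sigma> \<circ> k) A sequentially"
    if \<sigma>: "range \<sigma> \<subseteq> ?S" for \<sigma> :: "nat \<Rightarrow> 'a set"
  proof -
    have \<sigma>': "\<And>n. \<sigma> n \<in> Pasts R" "\<And>n. infdist x0 (\<sigma> n) \<le> r"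
      using \<sigma> by auto
    obtain k A where k: "strict_mono (k :: nat \<Rightarrow> nat)" "A \<in> Pasts R"
      "limitin (Pasts_topology R x0) (\<sigma> \<circ> k) A sequentially"
      by (rule Pasts_convergent_subsequence[of R \<sigma> x0 r, OF wb full proper \<sigma>']) blast
    have "(\<lambda>n. infdist x0 ((\<sigma> \<circ> k) n)) \<longlonglongrightarrow> infdist x0 A"
      using k(3) by (intro d1_tendsto_imp_infdist_tendsto[of x0]) (simp add: limitin_Pasts_iff[OF reg])
    then have "infdist x0 A \<le> r"
      by (rule LIMSEQ_le_const2) (use \<sigma>' in auto)
    then show ?thesis
      using k by blast
  qed
  then show ?thesis
    unfolding Pasts_topology_def Metric_space.compactin_sequentially[OF Metric_space_Pasts[OF reg]]
    by auto
qed

lemma future_compact_Pasts: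
  fixes R :: "'a::metric_space \<Rightarrow> 'a \<Rightarrow> bool"
  assumes wb: "well_behaved R" and full: "past_full R"
    and proper: "\<forall>K :: 'a set. closed K \<and> bounded K \<longrightarrow> compact K"
  shows "future_compact (Pasts_topology R x0) (ll_plus R)"
  unfolding future_compact_def
proof (intro allI impI)
  have reg: "regular_chr_space R"
    using wb by (simp add: well_behaved_def)
  interpret M: Metric_space "Pasts R" "cl_d1 x0"
    by (rule Metric_space_Pasts[OF reg])
  fix C assume C: "compactin (Pasts_topology R x0) C"
  then have CP: "C \<subseteq> Pasts R" and "M.mbounded C"
    using compactin_subset_topspace[OF C] M.compactin_imp_mbounded
    by (auto simp: Pasts_topology_def)
  then obtain A0 b where A0: "C \<subseteq> M.mcball A0 b"
    unfolding M.mbounded_def by blast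
  \<comment> \<open>The distance to \<open>x0\<close> is 1-Lipschitz with respect to
    \<open>d1\<close>, so a metric ball of radius \<open>b\<close> around \<open>A0\<close> bounds
    it by \<open>r\<close>.\<close>
  define r where "r = infdist x0 A0 + b"
  have r: "infdist x0 A \<le> r" if "A \<in> C" for A
  proof -
    have "d1 x0 A0 A \<le> b"
      using that A0 by (auto simp: M.mcball_def cl_d1_eq)
    then show ?thesis
      using infdist_diff_le_d1[of x0 A0 A] by (simp add: r_def)
  qed
  let ?S = "{B \<in> Pasts R. infdist x0 B \<le> r}"
  have S: "compactin (Pasts_topology R x0) ?S"
    by (rule compactin_Pasts_infdist_le[OF wb full proper])
  \<comment> \<open>Compact sets are closed in this Hausdorff topology, so the closure of the future
    of \<open>C\<close> stays inside \<open>?S\<close>.\<close>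
  have "closedin (Pasts_topology R x0) ?S"
    using S unfolding Pasts_topology_def by (intro compactin_imp_closedin M.Hausdorff_space_mtopology)
  moreover have "{B \<in> topspace (Pasts_topology R x0). \<exists>A\<in>C. ll_plus R A B} \<subseteq> ?S"
  proof clarify
    fix B A assume B: "B \<in> topspace (Pasts_topology R x0)" and A: "A \<in> C" "ll_plus R A B"
    then have B': "B \<in> Pasts R"
      by (simp add: Pasts_topology_def)
    then have "A \<subseteq> B" "A \<noteq> {}"
      using ll_plus_imp_subset[OF wb full _ _ A(2)] A(1) CP by (auto simp: Pasts_def)
    then have "infdist x0 B \<le> infdist x0 A"
      by (rule infdist_mono)
    then show "B \<in> Pasts R \<and> infdist x0 B \<le> r"
      using r[OF A(1)] B' by simp
  qed
  ultimately show "compactin (Pasts_topology R x0)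
      (Pasts_topology R x0 closure_of {B \<in> topspace (Pasts_topology R x0). \<exists>A\<in>C. ll_plus R A B})"
    using S by (meson closed_compactin closedin_closure_of closure_of_minimal)
qed

theorem theorem12:
  fixes R :: "'a::metric_space \<Rightarrow> 'a \<Rightarrow> bool" and x0 :: 'a
  assumes "well_behaved R"
    and "past_full R"
    and "intrinsic_metric (dist :: 'a \<Rightarrow> 'a \<Rightarrow> real)"
    and "\<forall>K :: 'a set. closed K \<and> bounded K \<longrightarrow> compact K"
  shows "future_compact (Pasts_topology R x0) (ll_plus R) \<and>
    (\<forall>p. \<forall>a :: nat \<Rightarrow> 'a. range a \<subseteq> I_plus R p \<longrightarrow>
       (\<exists>j A. strict_mono j \<and> A \<in> Pasts R \<and>
          limitin (Pasts_topology R x0) (\<lambda>n. I_minus R ((a \<circ> j) n)) A sequentially) \<and>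
       (\<forall>j A U. strict_mono j \<and> A \<in> Pasts R \<and>
          limitin (Pasts_topology R x0) (\<lambda>n. I_minus R ((a \<circ> j) n)) A sequentially \<and>
          maximal_IPast_in R U A \<longrightarrow>
          limitin (tau_minus R) (\<lambda>n. I_minus R ((a \<circ> j) n)) U sequentially))"
proof (intro conjI allI impI)
  have reg: "regular_chr_space R"
    using assms(1) by (simp add: well_behaved_def)
  have IP: "I_minus R x \<in> IPasts R" for x
    using I_minus_in_IPasts[OF assms(1,2)] .
  show "future_compact (Pasts_topology R x0) (ll_plus R)"
    by (rule future_compact_Pasts[OF assms(1,2,4)])
  fix p and a :: "nat \<Rightarrow> 'a" assume a: "range a \<subseteq> I_plus R p"
  have P: "I_minus R (a n) \<in> Pasts R" for n
    using IP IPasts_subset_Pasts[of R] by blast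
  \<comment> \<open>The common point \<open>p\<close> keeps all these pasts within distance
    \<open>dist x0 p\<close> of \<open>x0\<close>.\<close>
  have "p \<in> I_minus R (a n)" for n
    using a by (auto simp: I_plus_def I_minus_def)
  then have "infdist x0 (I_minus R (a n)) \<le> dist x0 p" for n
    by (rule infdist_le)
  then show "\<exists>j A. strict_mono j \<and> A \<in> Pasts R \<and>
      limitin (Pasts_topology R x0) (\<lambda>n. I_minus R ((a \<circ> j) n)) A sequentially"
    using Pasts_convergent_subsequence[of R "\<lambda>n. I_minus R (a n)" x0 "dist x0 p",
        OF assms(1,2,4) P]
    unfolding comp_def by metis
  \<comment> \<open>The last claim is shown for every convergent subsequence and its limit, not only
    for those obtained above.\<close>
  fix j A U
  assume "strict_mono j \<and> A \<in> Pasts R \<and>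
    limitin (Pasts_topology R x0) (\<lambda>n. I_minus R ((a \<circ> j) n)) A sequentially \<and>
    maximal_IPast_in R U A"
  then show "limitin (tau_minus R) (\<lambda>n. I_minus R ((a \<circ> j) n)) U sequentially"
    using limitin_tau_minus_of_Pasts_limit[OF reg IP] by blast
qed

end
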